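(* Let $d,m_u,p,N,n\ge 1$ be integers, $s=d+(N-1)p$, let $\mathbf A,\mathbf B,\mathbf E,Z$ be the matrices of the finite-horizon linear system described in the context, let $D\in\mathbb R^{N(d+m_u)\times N(d+m_u)}$ be symmetric positive semidefinite, $\hat w^1,\dots,\hat w^n\in\mathbb R^s$, $\rho\ge 0$, $\epsilon\ge 0$, $m\in\mathbb R^s$, and $\Sigma\in\mathbb R^{s\times s}$ symmetric positive definite. Consider the optimization problem $$\inf\ \ \lambda\rho+\frac1n\sum_{i=1}^n s_i$$ over $\lambda\in\mathbb R_+$, $Q\in\mathbb R^{s\times s}$ symmetric positive semidefinite, $s_i\in\mathbb R$, $\zeta_i\in\mathbb R$ ($i=1,\dots,n$) and $\mathbf\Phi\in\mathbb R^{N(d+m_u)\times s}$, subject to, for all $i=1,\dots,n$, with $M=\lambda\big(I+\tfrac{\epsilon}{2}\Sigma^{-1}\big)-Q$: (a) $M\succ 0$; (b) $\displaystyle\frac{\lambda\epsilon s}{2}\log\Big(\frac{\lambda\epsilon}{2}\Big)-\frac{\lambda\epsilon}{2}\log|\Sigma|-\frac{\lambda\epsilon}{2}\log|M|+\zeta_i\le s_i$ (understood on the domain $\lambda>0$, $M\succ0$, and with $0\log 0=0$ when $\epsilon=0$); (c) $\displaystyle\begin{bmatrix} M & \lambda\hat w^i+\frac{\lambda\epsilon}{2}\Sigma^{-1}m\\ \big(\lambda\hat w^i+\frac{\lambda\epsilon}{2}\Sigma^{-1}m\big)^\top & \zeta_i+\lambda\|\hat w^i\|^2+\frac{\lambda\epsilon}{2}m^\top\Sigma^{-1}m\end{bmatrix}\succeq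 0$; (d) $\displaystyle\begin{bmatrix} Q & (D^{1/2}\mathbf\Phi)^\top\\ D^{1/2}\mathbf\Phi & I\end{bmatrix}\succeq 0$; (e) $\mathbf\Phi$ is achievable. Then each of these constraints defines a convex set in the optimization variables $(\lambda,Q,\mathbf\Phi,(s_i)_{i},(\zeta_i)_{i})$.
   Context: Notation: $|\cdot|$ of a square matrix is the determinant, $\|\cdot\|$ the Euclidean norm, $\succeq,\succ$ the Loewner order, $D^{1/2}$ the positive semidefinite square root. System: $A_t\in\mathbb R^{d\times d}$, $B_t\in\mathbb R^{d\times m_u}$, $E_t\in\mathbb R^{d\times p}$ are given for $t=0,\dots,N-2$; $Z\in\mathbb R^{Nd\times Nd}$ is the block downshift matrix ($d\times d$ identities on the first block subdiagonal, zero elsewhere), $\mathbf A=\mathrm{blkdiag}(A_0,\dots,A_{N-2},0_{d\times d})$, $\mathbf B=\mathrm{blkdiag}(B_0,\dots,B_{N-2},0_{d\times m_u})$, $\mathbf E=\mathrm{blkdiag}(I_{d},E_0,\dots,E_{N-2})$. Achievable maps: $\mathbf\Phi=\begin{bmatrix}\mathbf\Phi_x\\ \mathbf\Phi_u\end{bmatrix}$ with $\mathbf\Phi_x\in\mathbb R^{Nd\times s}$, $\mathbf\Phi_u\in\mathbb R^{Nm_u\times s}$ is achievable if $\mathbf\Phi_x,\mathbf\Phi_u$ are block lower triangular ($N$ row blocks indexed by time; $N$ column blocks of sizes $d,p,\dots,p$) and $\begin{bmatrix} I-Z\mathbf A & -Z\mathbf B\end{bmatrix}\begin{bmatrix}\mathbf\Phi_x\\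 \mathbf\Phi_u\end{bmatrix}=\mathbf E$. *)

theory Defs
  imports "HOL-Analysis.Analysis"
begin

definition psd :: "real^'n^'n \<Rightarrow> bool" where
  "psd A \<longleftrightarrow> transpose A = A \<and> (\<forall>x. 0 \<le> x \<bullet> (A *v x))"

definition pd :: "real^'n^'n \<Rightarrow> bool" where
  "pd A \<longleftrightarrow> transpose A = A \<and> (\<forall>x. x \<noteq> 0 \<longrightarrow> 0 < x \<bullet> (A *v x))"

definition psd_sqrt :: "real^'n^'n \<Rightarrow> real^'n^'n" where
  "psd_sqrt A = (THE R. psd R \<and> R ** R = A)"

definition hcat :: "real^'a::finite^'r::finite \<Rightarrow> real^'b::finite^'r \<Rightarrow> real^('a + 'b)^'r" where
  "hcat A B = (\<chi> i j. case j of Inl k \<Rightarrow> A $ i $ k | Inr k \<Rightarrow> B $ i $ k)"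

definition vcat :: "real^'c^'a::finite \<Rightarrow> real^'c^'b::finite \<Rightarrow> real^'c^('a + 'b)" where
  "vcat A B = (\<chi> i. case i of Inl k \<Rightarrow> A $ k | Inr k \<Rightarrow> B $ k)"

definition block_mat ::
  "real^'a::finite^'r::finite \<Rightarrow> real^'b::finite^'r \<Rightarrow> real^'a^'q::finite \<Rightarrow> real^'b^'q \<Rightarrow> real^('a + 'b)^('r + 'q)" where
  "block_mat A B C D = vcat (hcat A B) (hcat C D)"

text \<open>
  The horizon is a nonempty finite linearly ordered type \<open>'t\<close> with \<open>N = CARD('t)\<close> elements, and
  \<open>time\<close> numbers them \<open>0, \<dots>, N - 1\<close>.  A stacked vector with \<open>N\<close> blocks in \<open>\<real>\<^sup>d\<close> is indexed by
  \<open>'t \<times> 'd\<close> with \<open>d = CARD('d)\<close>.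
\<close>

definition time :: "'t::{finite,linorder} \<Rightarrow> nat" where
  "time t = card {u. u < t}"

text \<open>
  The disturbance has a first block of size \<open>d\<close> (block number 0) followed by one block of size
  \<open>p\<close> for each time \<open>1, \<dots>, N - 1\<close>.  It cannot be a plain sum of product types since \<open>N - 1\<close> may
  be zero.
\<close>

typedef (overloaded) ('d, 't, 'p) noise =
  "{x :: 'd + ('t::{finite,linorder}) \<times> 'p. \<forall>t k. x = Inr (t, k) \<longrightarrow> time t \<noteq> 0}"
  by (rule exI[of _ "Inl undefined"]) simp

instance noise :: (finite, "{finite,linorder}", finite) finite
proof
  have "finite (range (Rep_noise :: ('a, 'b, 'c) noise \<Rightarrow> _))"
    by (rule finite)
  then show "finite (UNIV :: ('a, 'b, 'c) noise set)"
    by (rule finite_imageD) (simp add: inj_on_def Rep_noise_inject)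
qed

lemma time_eq_0_iff: "time (t :: 't::{finite,linorder}) = 0 \<longleftrightarrow> t = Min UNIV"
proof -
  have "time t = 0 \<longleftrightarrow> (\<forall>u. t \<le> u)"
    by (auto simp: time_def not_less)
  also have "\<dots> \<longleftrightarrow> t = Min UNIV"
    by (subst eq_Min_iff) auto
  finally show ?thesis .
qed

lemma card_noise:
  "CARD(('d::finite, 't::{finite,linorder}, 'p::finite) noise)
     = CARD('d) + (CARD('t) - 1) * CARD('p)"
proof -
  let ?S = "{x :: 'd + 't \<times> 'p. \<forall>t k. x = Inr (t, k) \<longrightarrow> time t \<noteq> 0}"
  have "?S = UNIV <+> ((- {Min (UNIV :: 't set)}) \<times> (UNIV :: 'p set))"
  proof (rule set_eqI)
    fix x :: "'d + 't \<times> 'p"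
    show "x \<in> ?S \<longleftrightarrow> x \<in> UNIV <+> ((- {Min (UNIV :: 't set)}) \<times> (UNIV :: 'p set))"
      by (cases x) (auto simp: time_eq_0_iff)
  qed
  moreover have "CARD(('d, 't, 'p) noise) = card ?S"
    by (rule type_definition.card[OF type_definition_noise])
  ultimately show ?thesis
    by (simp add: card_Plus card_cartesian_product Compl_eq_Diff_UNIV card_Diff_subset)
qed

text \<open>Rows of \<open>\<Phi>\<close>: the state rows \<open>Inl (t, i)\<close>, then the input rows \<open>Inr (t, j)\<close>.\<close>

type_synonym ('d, 't, 'm) xu = "('t \<times> 'd) + ('t \<times> 'm)"

definition down_shift :: "real^('t::{finite,linorder} \<times> 'd::finite)^('t \<times> 'd)" where
  "down_shift = (\<chi> i j. if time (fst i) = Suc (time (fst j)) \<and> snd i = snd j then 1 else 0)"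

definition blkdiag :: "(nat \<Rightarrow> real^'b::finite^'a::finite) \<Rightarrow> real^('t::{finite,linorder} \<times> 'b)^('t \<times> 'a)" where
  "blkdiag F = (\<chi> i j. if fst i = fst j then F (time (fst i)) $ snd i $ snd j else 0)"

definition blkdiag0 :: "(nat \<Rightarrow> real^'b::finite^'a::finite) \<Rightarrow> real^('t::{finite,linorder} \<times> 'b)^('t \<times> 'a)" where
  \<comment> \<open>\<open>blkdiag(F\<^sub>0, \<dots>, F\<^bsub>N-2\<^esub>, 0)\<close>\<close>
  "blkdiag0 F = blkdiag (\<lambda>t. if t < CARD('t) - 1 then F t else 0)"

definition noise_diag ::
  "(nat \<Rightarrow> real^'p::finite^'d::finite) \<Rightarrow> real^('d, 't::{finite,linorder}, 'p) noise^('t \<times> 'd)" where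
  \<comment> \<open>\<open>blkdiag(I, E\<^sub>0, \<dots>, E\<^bsub>N-2\<^esub>)\<close>\<close>
  "noise_diag E = (\<chi> i j. case Rep_noise j of
       Inl k \<Rightarrow> (if time (fst i) = 0 \<and> snd i = k then 1 else 0)
     | Inr (t, k) \<Rightarrow> (if fst i = t then E (time t - 1) $ snd i $ k else 0))"

definition noise_block :: "('d, 't::{finite,linorder}, 'p) noise \<Rightarrow> nat" where
  "noise_block j = (case Rep_noise j of Inl k \<Rightarrow> 0 | Inr (t, k) \<Rightarrow> time t)"

definition block_lower ::
  "real^('d::finite, 't::{finite,linorder}, 'p::finite) noise^('t \<times> 'a::finite) \<Rightarrow> bool" where
  "block_lower X \<longleftrightarrow> (\<forall>i j. time (fst i) < noise_block j \<longrightarrow> X $ i $ j = 0)"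

definition achievable ::
  "(nat \<Rightarrow> real^'d::finite^'d) \<Rightarrow> (nat \<Rightarrow> real^'m::finite^'d) \<Rightarrow> (nat \<Rightarrow> real^'p::finite^'d) \<Rightarrow>
   real^('d, 't::{finite,linorder}, 'p) noise^('d, 't, 'm) xu \<Rightarrow> bool" where
  "achievable A B E P \<longleftrightarrow>
     block_lower (\<chi> i. P $ Inl i) \<and> block_lower (\<chi> i. P $ Inr i) \<and>
     hcat (mat 1 - down_shift ** blkdiag0 A) (- (down_shift ** blkdiag0 B)) ** P = noise_diag E"

text \<open>Decision tuples are \<open>(\<lambda>, Q, \<Phi>, (s\<^sub>i)\<^sub>i, (\<zeta>\<^sub>i)\<^sub>i)\<close>; \<open>'n\<close> indexes the \<open>n\<close> samples.\<close>

type_synonym ('d, 't, 'm, 'p, 'n) vars =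
  "real \<times> (real^('d, 't, 'p) noise^('d, 't, 'p) noise) \<times>
   (real^('d, 't, 'p) noise^('d, 't, 'm) xu) \<times> (real^'n) \<times> (real^'n)"

definition var_domain ::
  "('d::finite, 't::{finite,linorder}, 'm::finite, 'p::finite, 'n::finite) vars set" where
  "var_domain = {(lam, Q, Phi, sv, zeta). 0 \<le> lam \<and> psd Q}"

definition Mmat :: "real \<Rightarrow> real^'s^'s \<Rightarrow> real \<Rightarrow> real^'s^'s \<Rightarrow> real^'s^'s" where
  "Mmat eps Sig lam Q = lam *\<^sub>R (mat 1 + (eps / 2) *\<^sub>R matrix_inv Sig) - Q"

end

theory Submission
  imports Defs
begin

text \<open>
  Constraint (b) asks for joint convexity of the perspective
  \<open>(a, M) \<mapsto> a s ln a - a ln det M = - a ln det (M / a)\<close> with \<open>a = \<lambda> \<epsilon> / 2\<close>.  Every positive definite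
  \<open>M\<close> satisfies Hadamard's inequality \<open>det M \<le> \<Prod>\<^sub>i (P\<^sup>T M P)\<^sub>i\<^sub>i\<close> for all \<open>P\<close> with \<open>det P = 1\<close>, and Gaussian
  elimination produces a \<open>P\<close> attaining equality.  So \<open>ln det M\<close> is a minimum over \<open>P\<close> of
  \<open>\<Sum>\<^sub>i ln (P\<^sup>T M P)\<^sub>i\<^sub>i\<close>, which reduces the claim to the concavity of \<open>ln\<close>.  The other constraints are
  preimages of convex cones or of affine subspaces under affine maps.
\<close>

text \<open>Each feasible set is a comprehension over nested pairs. Working componentwise reduces
  its convexity to the stability of one predicate under convex combinations, which the
  \<open>_combination\<close> lemmas below supply.\<close>

lemma convex_quintupleI:
  fixes R :: "'a::real_vector \<Rightarrow> 'b::real_vector \<Rightarrow> 'c::real_vector \<Rightarrow> 'd::real_vector \<Rightarrow>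
    'e::real_vector \<Rightarrow> bool"
  assumes "\<And>u v a b c d e a' b' c' d' e'. 0 \<le> u \<Longrightarrow> 0 \<le> v \<Longrightarrow> u + v = 1 \<Longrightarrow>
    R a b c d e \<Longrightarrow> R a' b' c' d' e' \<Longrightarrow>
    R (u *\<^sub>R a + v *\<^sub>R a') (u *\<^sub>R b + v *\<^sub>R b') (u *\<^sub>R c + v *\<^sub>R c')
      (u *\<^sub>R d + v *\<^sub>R d') (u *\<^sub>R e + v *\<^sub>R e')"
  shows "convex {(a, b, c, d, e). R a b c d e}"
  by (rule convexI) (clarsimp simp: assms)

subsection \<open>Cones of definite matrices\<close>

lemma transpose_add: "transpose (X + Y) = transpose X + transpose Y"
  by (simp add: transpose_def vec_eq_iff)

lemma quadratic_form_combination: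
  fixes X Y :: "real^'n^'n"
  shows "x \<bullet> ((u *\<^sub>R X + v *\<^sub>R Y) *v x) = u * (x \<bullet> (X *v x)) + v * (x \<bullet> (Y *v x))"
  by (simp add: matrix_vector_mult_add_rdistrib scaleR_matrix_vector_assoc[symmetric] inner_add_right)

lemma psd_combination:
  assumes "psd X" "psd Y" "0 \<le> u" "0 \<le> v"
  shows "psd (u *\<^sub>R X + v *\<^sub>R Y)"
  using assms
  by (simp add: psd_def quadratic_form_combination transpose_add transpose_scalar)

lemma pd_combination:
  assumes "pd X" "pd Y" "0 \<le> u" "0 \<le> v" "u + v = 1"
  shows "pd (u *\<^sub>R X + v *\<^sub>R Y)"
proof -
  have "0 < u * (x \<bullet> (X *v x)) + v * (x \<bullet> (Y *v x))" if "x \<noteq> 0" for x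
  \<comment> \<open>Strictness needs one positive weight: if \<open>u = 0\<close> then
    \<open>v = 1\<close>, otherwise the first summand is already positive.\<close>
  proof (cases "u = 0")
    case True
    then show ?thesis using assms that by (simp add: pd_def)
  next
    case False
    then have "0 < u * (x \<bullet> (X *v x))"
      using assms that by (simp add: pd_def)
    moreover have "0 \<le> v * (x \<bullet> (Y *v x))"
      using assms that by (simp add: pd_def less_imp_le)
    ultimately show ?thesis by linarith
  qed
  then show ?thesis
    using assms by (simp add: pd_def quadratic_form_combination transpose_add transpose_scalar)
qed

lemma matrix_mult_combination:
  fixes L :: "real^'n^'m"
  shows "L ** (u *\<^sub>R X + v *\<^sub>R Y) = u *\<^sub>R (L ** X) + v *\<^sub>R (L ** Y)"
  by (simp add: matrix_add_ldistrib matrix_scalar_ac scalar_matrix_assoc)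

lemma block_mat_combination:
  "block_mat (u *\<^sub>R A + v *\<^sub>R A') (u *\<^sub>R B + v *\<^sub>R B') (u *\<^sub>R C + v *\<^sub>R C') (u *\<^sub>R D + v *\<^sub>R D')
     = u *\<^sub>R block_mat A B C D + v *\<^sub>R block_mat A' B' C' D'"
  by (simp add: block_mat_def vcat_def hcat_def vec_eq_iff split: sum.split)

lemma Mmat_combination:
  "Mmat eps Sig (u *\<^sub>R lam + v *\<^sub>R lam') (u *\<^sub>R Q + v *\<^sub>R Q')
     = u *\<^sub>R Mmat eps Sig lam Q + v *\<^sub>R Mmat eps Sig lam' Q'"
  by (simp add: Mmat_def algebra_simps)

subsection \<open>Congruence diagonalisation and Hadamard's inequality\<close>

lemma quadratic_form_congruence:
  fixes M P :: "real^'n^'n"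
  shows "x \<bullet> ((transpose P ** M ** P) *v y) = (P *v x) \<bullet> (M *v (P *v y))"
  by (metis dot_lmul_matrix matrix_vector_mul_assoc transpose_matrix_vector inner_commute)

lemma pd_congruence:
  fixes M P :: "real^'n^'n"
  assumes "pd M" "det P \<noteq> 0"
  shows "pd (transpose P ** M ** P)"
proof -
  have "P *v x \<noteq> 0" if "x \<noteq> 0" for x
    using assms(2) that
    by (metis invertible_det_nz matrix_left_invertible_ker invertible_def)
  then show ?thesis
    using assms(1)
    by (simp add: pd_def quadratic_form_congruence matrix_transpose_mul matrix_mul_assoc)
qed

lemma matrix_entry_inner: "(M :: real^'n^'m) $ i $ j = axis i 1 \<bullet> (M *v axis j 1)"
  by (simp add: inner_axis' matrix_vector_mul_component inner_axis)

lemma pd_diagonal_pos: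
  fixes M :: "real^'n^'n"
  assumes "pd M"
  shows "0 < M $ i $ i"
  using assms by (simp add: pd_def matrix_entry_inner)

text \<open>The induction clears one index \<open>k\<close> at a time: \<open>K\<close> holds the indices not yet cleared, and
  clearing replaces the remaining block by its Schur complement.\<close>

lemma pd_congruent_diagonal_aux:
  fixes M :: "real^'n^'n"
  assumes "finite K" "pd M" "\<And>i j. i \<noteq> j \<Longrightarrow> M $ i $ j \<noteq> 0 \<Longrightarrow> i \<in> K \<and> j \<in> K"
  shows "\<exists>P. det P = 1 \<and> (\<forall>i j. i \<noteq> j \<longrightarrow> (transpose P ** M ** P) $ i $ j = 0) \<and>
    (\<forall>i. (transpose P ** M ** P) $ i $ i \<le> M $ i $ i)"
  using assms
proof (induction K arbitrary: M rule: finite_induct)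
  case empty
  then show ?case
    by (intro exI[of _ "mat 1"]) (auto simp: transpose_mat)
next
  case (insert k K)
  let ?c = "\<lambda>j. M $ k $ j / M $ k $ k"
  \<comment> \<open>\<open>P\<close> is the identity except in row \<open>k\<close>, whose entry in
    column \<open>j\<close> is minus the multiplier that eliminates entry \<open>(k, j)\<close> of
    \<open>M\<close> with pivot \<open>M $ k $ k\<close>.\<close>
  define r :: "real^'n" where "r = (\<Sum>j\<in>UNIV - {k}. (- ?c j) *\<^sub>R row j (mat 1))"
  define P :: "real^'n^'n" where "P = (\<chi> i. if i = k then row k (mat 1) + r else row i (mat 1))"
  define M' where "M' = transpose P ** M ** P"
  have pos: "0 < M $ k $ k"
    using insert.prems(1) by (rule pd_diagonal_pos)
  have "transpose M = M"
    using insert.prems(1) by (simp add: pd_def)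
  then have sym: "M $ i $ j = M $ j $ i" for i j
    by (metis transpose_def vec_lambda_beta)
  \<comment> \<open>Adding to one row of the identity a combination of its other rows preserves the
    determinant.\<close>
  have "r \<in> vec.span {row j (mat 1) |j. j \<noteq> k}"
    unfolding r_def scalar_mult_eq_scaleR[symmetric]
    by (intro vec.span_sum vec.span_scale vec.span_base) auto
  then have det_P: "det P = 1"
    unfolding P_def by (subst det_row_span) (simp_all add: det_I)
  have "r $ j = (\<Sum>i\<in>UNIV - {k}. if i = j then - ?c j else 0)" for j
    unfolding r_def sum_component by (intro sum.cong) (auto simp: row_def mat_def)
  then have r: "r $ j = (if j = k then 0 else - ?c j)" for j
    by (simp add: sum.delta)
  have "P $ i $ j = (if i = k then if j = k then 1 else - ?c j else if i = j then 1 else 0)" for i j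
    unfolding P_def by (simp add: r row_def mat_def)
  then have col: "P *v axis j 1 = (if j = k then axis k 1 else axis j 1 - ?c j *\<^sub>R axis k 1)" for j
    unfolding matrix_vector_mult_basis by (simp add: vec_eq_iff column_def axis_def)
  \<comment> \<open>Row and column \<open>k\<close> are cleared except for the pivot, and the rest
    is the Schur complement.\<close>
  have M': "M' $ i $ j = (if i = k \<or> j = k then if i = j then M $ k $ k else 0
      else M $ i $ j - M $ k $ i * M $ k $ j / M $ k $ k)" for i j
  proof -
    have "M' $ i $ j = (P *v axis i 1) \<bullet> (M *v (P *v axis j 1))"
      unfolding matrix_entry_inner[of M'] unfolding M'_def by (rule quadratic_form_congruence)
    also have "\<dots> = (if i = k then if j = k then M $ k $ k else M $ k $ j - ?c j * M $ k $ k
        else if j = k then M $ i $ k - ?c i * M $ k $ k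
        else M $ i $ j - ?c i * M $ k $ j - ?c j * (M $ i $ k - ?c i * M $ k $ k))"
      unfolding col
      by (cases "i = k"; cases "j = k"; simp only: simp_thms if_True if_False matrix_vector_mult_diff_distrib
          matrix_vector_mult_scaleR inner_diff_left inner_diff_right inner_scaleR_left
          inner_scaleR_right matrix_entry_inner[of M, symmetric])
    finally show ?thesis
      using pos sym[of i k] by simp
  qed
  have "pd M'"
    unfolding M'_def using insert.prems(1) det_P by (intro pd_congruence) auto
  \<comment> \<open>Fill-in at \<open>(i, j)\<close> requires both \<open>(k, i)\<close> and
    \<open>(k, j)\<close> to be nonzero in \<open>M\<close>, so it stays inside
    \<open>K\<close>.\<close>
  moreover have "i \<in> K \<and> j \<in> K" if "i \<noteq> j" "M' $ i $ j \<noteq> 0" for i j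
  proof -
    have k: "i \<noteq> k" "j \<noteq> k"
      using that by (auto simp: M')
    then have "M $ i $ j \<noteq> 0 \<or> M $ k $ i \<noteq> 0 \<and> M $ k $ j \<noteq> 0"
      using that by (auto simp: M')
    then show ?thesis
      using insert.prems(2)[of i j] insert.prems(2)[of k i] insert.prems(2)[of k j] k that(1)
      by auto
  qed
  ultimately have "\<exists>P. det P = 1 \<and> (\<forall>i j. i \<noteq> j \<longrightarrow> (transpose P ** M' ** P) $ i $ j = 0) \<and>
      (\<forall>i. (transpose P ** M' ** P) $ i $ i \<le> M' $ i $ i)"
    by (rule insert.IH)
  then obtain P' where P': "det P' = 1"
    "\<And>i j. i \<noteq> j \<Longrightarrow> (transpose P' ** M' ** P') $ i $ j = 0"
    "\<And>i. (transpose P' ** M' ** P') $ i $ i \<le> M' $ i $ i"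
    by blast
  have eq: "transpose (P ** P') ** M ** (P ** P') = transpose P' ** M' ** P'"
    by (simp add: M'_def matrix_transpose_mul matrix_mul_assoc)
  \<comment> \<open>Off the pivot, a square divided by the positive pivot is subtracted. Diagonal
    entries therefore never grow, which is what yields Hadamard's inequality.\<close>
  have "M' $ i $ i \<le> M $ i $ i" for i
    using pos by (simp add: M')
  then have "(transpose P' ** M' ** P') $ i $ i \<le> M $ i $ i" for i
    using P'(3) order_trans by blast
  then have "det (P ** P') = 1 \<and>
      (\<forall>i j. i \<noteq> j \<longrightarrow> (transpose (P ** P') ** M ** (P ** P')) $ i $ j = 0) \<and>
      (\<forall>i. (transpose (P ** P') ** M ** (P ** P')) $ i $ i \<le> M $ i $ i)"
    unfolding eq using P'(1,2) det_P by (simp add: det_mul)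
  then show ?case by (rule exI)
qed

lemma pd_congruent_diagonal:
  fixes M :: "real^'n^'n"
  assumes "pd M"
  obtains P where "det P = 1" "\<And>i j. i \<noteq> j \<Longrightarrow> (transpose P ** M ** P) $ i $ j = 0"
    "\<And>i. (transpose P ** M ** P) $ i $ i \<le> M $ i $ i"
  using pd_congruent_diagonal_aux[OF finite assms, of UNIV] by auto

lemma det_congruence:
  fixes M P :: "real^'n^'n"
  assumes "det P = 1"
  shows "det (transpose P ** M ** P) = det M"
  using assms by (simp add: det_mul)

text \<open>The diagonalising \<open>P\<close> has determinant 1, so \<open>det M\<close> is the
  product of the new diagonal entries. Each of these is positive and at most the corresponding entry
  of \<open>M\<close>.\<close>

lemma
  fixes M :: "real^'n^'n"
  assumes "pd M"
  shows pd_det_pos: "0 < det M"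
    and hadamard_inequality: "det M \<le> (\<Prod>i\<in>UNIV. M $ i $ i)"
proof -
  obtain P where P: "det P = 1" "\<And>i j. i \<noteq> j \<Longrightarrow> (transpose P ** M ** P) $ i $ j = 0"
    "\<And>i. (transpose P ** M ** P) $ i $ i \<le> M $ i $ i"
    using pd_congruent_diagonal[OF assms] by blast
  have pos: "0 < (transpose P ** M ** P) $ i $ i" for i
    using pd_diagonal_pos[OF pd_congruence[OF assms]] P(1) by simp
  have det: "det M = (\<Prod>i\<in>UNIV. (transpose P ** M ** P) $ i $ i)"
    using det_diagonal[OF P(2)] det_congruence[OF P(1)] by metis
  show "0 < det M"
    unfolding det using pos by (intro prod_pos) auto
  show "det M \<le> (\<Prod>i\<in>UNIV. M $ i $ i)"
    unfolding det using pos P(3) by (intro prod_mono) (auto intro: less_imp_le)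
qed

lemma ln_det_le_congruence:
  fixes M P :: "real^'n^'n"
  assumes "pd M" "det P = 1"
  shows "ln (det M) \<le> (\<Sum>i\<in>UNIV. ln ((transpose P ** M ** P) $ i $ i))"
proof -
  let ?M = "transpose P ** M ** P"
  have pd: "pd ?M"
    using assms by (intro pd_congruence) auto
  have "ln (det M) \<le> ln (\<Prod>i\<in>UNIV. ?M $ i $ i)"
    using hadamard_inequality[OF pd] pd_det_pos[OF assms(1)] det_congruence[OF assms(2), of M]
    by simp
  also have "\<dots> = (\<Sum>i\<in>UNIV. ln (?M $ i $ i))"
    using pd_diagonal_pos[OF pd] by (intro ln_prod finite) (metis less_irrefl)
  finally show ?thesis .
qed

subsection \<open>Perspectives of the logarithm\<close>

text \<open>Joint concavity of \<open>a * ln (x / a)\<close>. A single tangent of \<open>ln\<close>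
  serves both points, and its two correction terms cancel after weighting.\<close>

lemma ln_perspective_concave:
  fixes a b x y :: real
  assumes "0 < a" "0 < b" "0 < x" "0 < y" "0 \<le> u" "0 \<le> v" "u + v = 1"
  shows "u * (a * (ln x - ln a)) + v * (b * (ln y - ln b))
    \<le> (u * a + v * b) * (ln (u * x + v * y) - ln (u * a + v * b))"
proof -
  define c where "c = u * a + v * b"
  define z where "z = u * x + v * y"
  have pos: "0 < u * r + v * t" if "0 < r" "0 < t" for r t
    using assms that
    by (metis add_nonneg_pos add_pos_nonneg mult_nonneg_nonneg mult_pos_pos less_eq_real_def
        add.right_neutral zero_neq_one)
  have c: "0 < c" and z: "0 < z"
    using pos assms by (auto simp: c_def z_def)
  text \<open>The tangent of \<open>ln\<close> at \<open>z / c\<close>.\<close>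
  have tangent: "r * (ln t - ln r) \<le> r * (ln z - ln c) + (t * c / z - r)" if "0 < r" "0 < t" for r t
  proof -
    have "ln (t * c / (r * z)) \<le> t * c / (r * z) - 1"
      using that c z by (intro ln_le_minus_one) auto
    then have "r * (ln t + ln c - (ln r + ln z)) \<le> r * (t * c / (r * z) - 1)"
      using that c z by (intro mult_left_mono) (auto simp: ln_div ln_mult)
    also have "r * (t * c / (r * z) - 1) = t * c / z - r"
      using that by (simp add: field_simps)
    finally show ?thesis by (simp add: algebra_simps)
  qed
  have "u * (a * (ln x - ln a)) + v * (b * (ln y - ln b))
    \<le> u * (a * (ln z - ln c) + (x * c / z - a)) + v * (b * (ln z - ln c) + (y * c / z - b))"
    using assms tangent by (intro add_mono mult_left_mono) auto
  also have "\<dots> = c * (ln z - ln c) + (z * c / z - c)"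
    by (simp add: c_def z_def algebra_simps add_divide_distrib)
  also have "\<dots> = c * (ln z - ln c)"
    using z by simp
  finally show ?thesis by (simp add: c_def z_def)
qed

text \<open>One \<open>P\<close>, chosen to diagonalise the combination \<open>Z\<close>, is used
  for all three matrices. It gives equality for \<open>Z\<close> and Hadamard upper bounds for
  \<open>X\<close> and \<open>Y\<close>, so the scalar case can be summed over the diagonal.\<close>

lemma ln_det_perspective_concave:
  fixes X Y :: "real^'n^'n"
  assumes "pd X" "pd Y" "0 < a" "0 < b" "0 \<le> u" "0 \<le> v" "u + v = 1"
  shows "u * (a * (ln (det X) - real CARD('n) * ln a)) + v * (b * (ln (det Y) - real CARD('n) * ln b))
    \<le> (u * a + v * b) * (ln (det (u *\<^sub>R X + v *\<^sub>R Y)) - real CARD('n) * ln (u * a + v * b))"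
proof -
  define Z where "Z = u *\<^sub>R X + v *\<^sub>R Y"
  have "pd Z"
    unfolding Z_def using assms by (intro pd_combination)
  from pd_congruent_diagonal[OF this] obtain P where P: "det P = 1" "\<And>i j. i \<noteq> j \<Longrightarrow> (transpose P ** Z ** P) $ i $ j = 0"
    "\<And>i. (transpose P ** Z ** P) $ i $ i \<le> Z $ i $ i"
    by blast
  define x y z where "x = (\<lambda>i. (transpose P ** X ** P) $ i $ i)"
    and "y = (\<lambda>i. (transpose P ** Y ** P) $ i $ i)"
    and "z = (\<lambda>i. (transpose P ** Z ** P) $ i $ i)"
  have pos: "0 < x i" "0 < y i" "0 < z i" for i
    unfolding x_def y_def z_def using P(1) assms(1,2) \<open>pd Z\<close>
    by (auto intro!: pd_diagonal_pos pd_congruence)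
  \<comment> \<open>For fixed \<open>P\<close>, the diagonal of \<open>P^T M P\<close> depends
    linearly on \<open>M\<close>.\<close>
  have z: "z i = u * x i + v * y i" for i
    unfolding x_def y_def z_def matrix_entry_inner quadratic_form_congruence
    by (simp add: Z_def quadratic_form_combination)
  have bound: "t * (c * (ln (det M) - real CARD('n) * ln c))
      \<le> (\<Sum>i\<in>UNIV. t * (c * (ln ((transpose P ** M ** P) $ i $ i) - ln c)))"
    if "pd M" "0 < c" "0 \<le> t" for M :: "real^'n^'n" and c t
  proof -
    have "t * (c * (ln (det M) - real CARD('n) * ln c))
      \<le> t * (c * ((\<Sum>i\<in>UNIV. ln ((transpose P ** M ** P) $ i $ i)) - real CARD('n) * ln c))"
      using ln_det_le_congruence[OF that(1) P(1)] that by (intro mult_left_mono) auto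
    then show ?thesis
      by (simp add: sum_subtractf flip: sum_distrib_left)
  qed
  have "det Z = (\<Prod>i\<in>UNIV. z i)"
    using det_diagonal[OF P(2)] det_congruence[OF P(1), of Z] by (simp add: z_def)
  then have ln_Z: "ln (det Z) = (\<Sum>i\<in>UNIV. ln (z i))"
    using pos(3) by (metis finite less_irrefl ln_prod)
  have "u * (a * (ln (det X) - real CARD('n) * ln a)) + v * (b * (ln (det Y) - real CARD('n) * ln b))
    \<le> (\<Sum>i\<in>UNIV. u * (a * (ln (x i) - ln a))) + (\<Sum>i\<in>UNIV. v * (b * (ln (y i) - ln b)))"
    unfolding x_def y_def using assms by (intro add_mono bound)
  also have "\<dots> = (\<Sum>i\<in>UNIV. u * (a * (ln (x i) - ln a)) + v * (b * (ln (y i) - ln b)))"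
    by (simp add: sum.distrib)
  also have "\<dots> \<le> (\<Sum>i\<in>UNIV. (u * a + v * b) * (ln (z i) - ln (u * a + v * b)))"
    unfolding z using assms pos by (intro sum_mono ln_perspective_concave)
  also have "\<dots> = (u * a + v * b) * (ln (det Z) - real CARD('n) * ln (u * a + v * b))"
    by (simp add: ln_Z sum_subtractf flip: sum_distrib_left)
  finally show ?thesis by (simp add: Z_def)
qed

subsection \<open>The constraints\<close>

lemma convex_var_domain: "convex var_domain"
  unfolding var_domain_def by (rule convex_quintupleI) (auto intro: psd_combination)

text \<open>With \<open>g\<close> constant, the left side is linear in \<open>(lam, z)\<close> minus
  the concave perspective \<open>?F\<close>, hence jointly convex.\<close>

lemma log_det_constraint_combination:
  fixes X Y :: "real^'n^'n"
  assumes "0 \<le> eps" "0 < lam" "0 < lam'" "pd X" "pd Y" "0 \<le> u" "0 \<le> v" "u + v = 1"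
    and "lam * eps * real CARD('n) / 2 * ln (lam * eps / 2) - lam * eps / 2 * g
      - lam * eps / 2 * ln (det X) + z \<le> t"
    and "lam' * eps * real CARD('n) / 2 * ln (lam' * eps / 2) - lam' * eps / 2 * g
      - lam' * eps / 2 * ln (det Y) + z' \<le> t'"
  shows "(u * lam + v * lam') * eps * real CARD('n) / 2 * ln ((u * lam + v * lam') * eps / 2)
      - (u * lam + v * lam') * eps / 2 * g
      - (u * lam + v * lam') * eps / 2 * ln (det (u *\<^sub>R X + v *\<^sub>R Y)) + (u * z + v * z')
    \<le> u * t + v * t'"
proof -
  let ?N = "real CARD('n)"
  have rearrange: "l * eps * ?N / 2 * ln (l * eps / 2) - l * eps / 2 * g - l * eps / 2 * h + r
    = r - l * eps / 2 * g - (l * eps / 2) * (h - ?N * ln (l * eps / 2))" for l h r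
    by (simp add: algebra_simps)
  let ?F = "\<lambda>l M. (l * eps / 2) * (ln (det M) - ?N * ln (l * eps / 2)) :: real"
  have concave: "u * ?F lam X + v * ?F lam' Y \<le> ?F (u * lam + v * lam') (u *\<^sub>R X + v *\<^sub>R Y)"
  \<comment> \<open>The perspective lemma needs \<open>lam * eps / 2\<close> positive. For
    \<open>eps = 0\<close> both sides vanish, whatever value \<open>ln 0\<close> has.\<close>
  proof (cases "eps = 0")
    case True
    then show ?thesis by simp
  next
    case False
    have mix: "(u * lam + v * lam') * eps / 2 = u * (lam * eps / 2) + v * (lam' * eps / 2)"
      by (simp add: field_simps)
    show ?thesis
      unfolding mix using assms False by (intro ln_det_perspective_concave) auto
  qed
  have "u * (z - lam * eps / 2 * g - ?F lam X) \<le> u * t"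
    "v * (z' - lam' * eps / 2 * g - ?F lam' Y) \<le> v * t'"
    using assms unfolding rearrange by (auto intro!: mult_left_mono)
  then have "u * (z - lam * eps / 2 * g) + v * (z' - lam' * eps / 2 * g)
    - (u * ?F lam X + v * ?F lam' Y) \<le> u * t + v * t'"
    by (simp only: right_diff_distrib)
  moreover have "(u * z + v * z') - (u * lam + v * lam') * eps / 2 * g
    = u * (z - lam * eps / 2 * g) + v * (z' - lam' * eps / 2 * g)"
    by (simp add: field_simps)
  ultimately show ?thesis
    unfolding rearrange using concave by linarith
qed

text \<open>Block triangularity is a linear condition. The system equation is affine, and
  \<open>u + v = 1\<close> reproduces its right-hand side.\<close>

lemma achievable_combination:
  assumes "achievable A B E P" "achievable A B E P'" "u + v = 1"
  shows "achievable A B E (u *\<^sub>R P + v *\<^sub>R P')"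
proof -
  have "u *\<^sub>R X + v *\<^sub>R X = X" for X :: "real^'x^'y"
    using assms(3) by (metis scaleR_add_left scaleR_one)
  then show ?thesis
    using assms(1,2)
    by (simp add: achievable_def block_lower_def matrix_mult_combination)
qed

theorem proposition2:
  fixes A :: "nat \<Rightarrow> real^'d^'d"
    and B :: "nat \<Rightarrow> real^'m^'d"
    and E :: "nat \<Rightarrow> real^'p^'d"
    and D :: "real^('d, 't::{finite,linorder}, 'm) xu^('d, 't, 'm) xu"
    and w :: "'n::finite \<Rightarrow> real^('d::finite, 't, 'p::finite) noise"
    and rho eps s :: real
    and mu :: "real^('d, 't, 'p) noise"
    and Sig :: "real^('d, 't, 'p) noise^('d, 't, 'p) noise"
    and V :: "('d, 't, 'm::finite, 'p, 'n) vars set"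
  assumes "psd D" and "0 \<le> rho" and "0 \<le> eps" and "pd Sig"
    and "V = var_domain"
    and "s = real (CARD('d) + (CARD('t) - 1) * CARD('p))"
  shows
    "convex V \<and>
     convex {(lam, Q, Phi, sv, zeta). (lam, Q, Phi, sv, zeta) \<in> V \<and>
        pd (Mmat eps Sig lam Q)} \<and>
     (\<forall>i. convex {(lam, Q, Phi, sv, zeta). (lam, Q, Phi, sv, zeta) \<in> V \<and>
        0 < lam \<and> pd (Mmat eps Sig lam Q) \<and>
        lam * eps * s / 2 * ln (lam * eps / 2)
          - lam * eps / 2 * ln (det Sig)
          - lam * eps / 2 * ln (det (Mmat eps Sig lam Q))
          + zeta $ i \<le> sv $ i}) \<and>
     (\<forall>i. convex {(lam, Q, Phi, sv, zeta). (lam, Q, Phi, sv, zeta) \<in> V \<and>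
        (let b = lam *\<^sub>R w i + (lam * eps / 2) *\<^sub>R (matrix_inv Sig *v mu);
             c = zeta $ i + lam * (norm (w i))\<^sup>2
                   + lam * eps / 2 * (mu \<bullet> (matrix_inv Sig *v mu))
         in psd (block_mat (Mmat eps Sig lam Q) (columnvector b :: real^1^_)
                           (rowvector b :: real^_^1) (mat c :: real^1^1)))}) \<and>
     convex {(lam, Q, Phi, sv, zeta). (lam, Q, Phi, sv, zeta) \<in> V \<and>
        psd (block_mat Q (transpose (psd_sqrt D ** Phi)) (psd_sqrt D ** Phi) (mat 1))} \<and>
     convex {(lam, Q, Phi, sv, zeta). (lam, Q, Phi, sv, zeta) \<in> V \<and>
        achievable A B E Phi}"
proof -
  have V: "convex V"
    using convex_var_domain assms(5) by simp
  \<comment> \<open>Identifies \<open>s\<close> with the order of \<open>M\<close>, the factor of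
    \<open>ln a\<close> in the determinant perspective.\<close>
  have s: "s = real CARD(('d, 't, 'p) noise)"
    using assms(6) by (simp add: card_noise)
  have restrict: "convex {(lam, Q, Phi, sv, zeta). (lam, Q, Phi, sv, zeta) \<in> V \<and> R lam Q Phi sv zeta}"
    if "convex {(lam, Q, Phi, sv, zeta). R lam Q Phi sv zeta}" for R
  proof -
    have "{(lam, Q, Phi, sv, zeta). (lam, Q, Phi, sv, zeta) \<in> V \<and> R lam Q Phi sv zeta}
      = V \<inter> {(lam, Q, Phi, sv, zeta). R lam Q Phi sv zeta}"
      by auto
    then show ?thesis using V that by (simp add: convex_Int)
  qed
  show ?thesis
  \<comment> \<open>The five cases are the constraints (a) to (e) in order, each freed from the
    domain \<open>V\<close>.\<close>
  proof ((intro conjI allI V; rule restrict; rule convex_quintupleI), goal_cases)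
    case 1
    then show ?case by (simp only: Mmat_combination pd_combination)
  next
    case (2 i u v lam Q Phi sv zeta lam' Q' Phi' sv' zeta')
    then have "0 < u * lam + v * lam'"
      by (smt (verit) mult_nonneg_nonneg mult_pos_pos)
    then show ?case
      using 2 log_det_constraint_combination[OF assms(3), of lam lam' "Mmat eps Sig lam Q"
          "Mmat eps Sig lam' Q'" u v "ln (det Sig)" "zeta $ i" "sv $ i" "zeta' $ i" "sv' $ i"]
      unfolding s Mmat_combination by (simp add: pd_combination)
  next
    case (3 i u v lam Q Phi sv zeta lam' Q' Phi' sv' zeta')
    \<comment> \<open>As functions of the variables, \<open>b\<close> and \<open>c\<close> are
      linear, so the whole matrix in (c) is linear and the semidefinite cone pulls back to a convex
      set.\<close>
    define b where "b = (\<lambda>l. l *\<^sub>R w i + (l * eps / 2) *\<^sub>R (matrix_inv Sig *v mu))"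
    define c where "c = (\<lambda>l (z::real^'n). z $ i + l * (norm (w i))\<^sup>2
      + l * eps / 2 * (mu \<bullet> (matrix_inv Sig *v mu)))"
    have b: "columnvector (b (u *\<^sub>R lam + v *\<^sub>R lam')) =
        u *\<^sub>R columnvector (b lam) + v *\<^sub>R (columnvector (b lam') :: real^1^_)"
      "rowvector (b (u *\<^sub>R lam + v *\<^sub>R lam')) =
        u *\<^sub>R rowvector (b lam) + v *\<^sub>R (rowvector (b lam') :: real^_^1)"
      by (simp_all add: b_def columnvector_def rowvector_def vec_eq_iff field_simps)
    have c: "mat (c (u *\<^sub>R lam + v *\<^sub>R lam') (u *\<^sub>R zeta + v *\<^sub>R zeta')) =
        u *\<^sub>R mat (c lam zeta) + v *\<^sub>R (mat (c lam' zeta') :: real^1^1)"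
      by (simp add: c_def mat_def vec_eq_iff field_simps)
    have "psd (block_mat (Mmat eps Sig lam Q) (columnvector (b lam) :: real^1^_)
        (rowvector (b lam) :: real^_^1) (mat (c lam zeta) :: real^1^1))"
      "psd (block_mat (Mmat eps Sig lam' Q') (columnvector (b lam') :: real^1^_)
        (rowvector (b lam') :: real^_^1) (mat (c lam' zeta') :: real^1^1))"
      using 3(4,5) by (simp_all only: Let_def b_def c_def)
    with 3(1,2) have "psd (block_mat (Mmat eps Sig (u *\<^sub>R lam + v *\<^sub>R lam') (u *\<^sub>R Q + v *\<^sub>R Q'))
        (columnvector (b (u *\<^sub>R lam + v *\<^sub>R lam')) :: real^1^_)
        (rowvector (b (u *\<^sub>R lam + v *\<^sub>R lam')) :: real^_^1)
        (mat (c (u *\<^sub>R lam + v *\<^sub>R lam') (u *\<^sub>R zeta + v *\<^sub>R zeta')) :: real^1^1))"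
      by (simp only: Mmat_combination b c block_mat_combination psd_combination)
    then show ?case
      by (simp only: Let_def b_def c_def)
  next
    case (4 u v lam Q Phi sv zeta lam' Q' Phi' sv' zeta')
    let ?R = "psd_sqrt D"
    have R: "?R ** (u *\<^sub>R Phi + v *\<^sub>R Phi') = u *\<^sub>R (?R ** Phi) + v *\<^sub>R (?R ** Phi')"
      by (simp add: matrix_mult_combination)
    have T: "transpose (u *\<^sub>R (?R ** Phi) + v *\<^sub>R (?R ** Phi'))
      = u *\<^sub>R transpose (?R ** Phi) + v *\<^sub>R transpose (?R ** Phi')"
      by (simp add: transpose_add transpose_scalar)
    \<comment> \<open>The constant identity block makes (d) affine rather than linear. Splitting it
      by \<open>u + v = 1\<close> lets the block matrices be combined.\<close>
    have I: "mat 1 = u *\<^sub>R mat 1 + v *\<^sub>R (mat 1 :: real^('d, 't, 'm) xu^('d, 't, 'm) xu)"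
      using 4(3) by (metis scaleR_add_left scaleR_one)
    show ?case
      unfolding R T by (subst I) (simp only: block_mat_combination psd_combination 4)
  next
    case 5
    then show ?case by (simp only: achievable_combination)
  qed
qed

end
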